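(* Let $a,b\in\mathbb{Z}$ and let $m>1$ be an integer. Assume that $a\ge 2$, $b\ge -(a-1)m$, and $\gcd(b,m)=1$. Then $S_{a,b}(m)$ is the smallest numerical semigroup of multiplicity $m$ closed under $T_{a,b}$; that is, $S_{a,b}(m)$ is a numerical semigroup of multiplicity $m$ closed under $T_{a,b}$, and it is contained in every numerical semigroup of multiplicity $m$ closed under $T_{a,b}$.
   Context: $\mathbb{N}=\{0,1,2,\dots\}$. A numerical semigroup is a submonoid $S$ of $(\mathbb{N},+)$ such that $\mathbb{N}\setminus S$ is finite; its multiplicity $\operatorname{m}(S)$ is its smallest positive element. For $a,b\in\mathbb{Z}$, $T_{a,b}:\mathbb{Z}\to\mathbb{Z}$ is the affine map $T_{a,b}(z)=az+b$; $T_{a,b}^0$ is the identity and $T_{a,b}^i$ is the $i$-fold composition of $T_{a,b}$ with itself. A numerical semigroup $S$ is closed under $T_{a,b}$ if $T_{a,b}(S\setminus\{0\})\subseteq S\setminus\{0\}$. $S_{a,b}(m)=\langle T_{a,b}^i(m)\mid i\ge 0\rangle$ is the additive monoid generated by the orbit of $m$ under $T_{a,b}$ (the set of all finite sums of orbit elements, including $0$). *)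

theory Defs
  imports Main
begin

text \<open>
  The natural numbers are taken as the subset \<open>\<nat>\<close> of the integers, so that numerical semigroups
  and the integer-valued affine maps live in the same type.
\<close>

definition numerical_semigroup :: "int set \<Rightarrow> bool" where
  "numerical_semigroup S \<longleftrightarrow>
     S \<subseteq> \<nat> \<and> 0 \<in> S \<and> (\<forall>x\<in>S. \<forall>y\<in>S. x + y \<in> S) \<and> finite (\<nat> - S)"

definition ns_multiplicity :: "int set \<Rightarrow> int" where
  "ns_multiplicity S = (LEAST x. x \<in> S \<and> 0 < x)"

definition affine_map :: "int \<Rightarrow> int \<Rightarrow> int \<Rightarrow> int" where
  "affine_map a b z = a * z + b"

definition closed_under_affine :: "int \<Rightarrow> int \<Rightarrow> int set \<Rightarrow> bool" where
  "closed_under_affine a b S \<longleftrightarrow> affine_map a b ` (S - {0}) \<subseteq> S - {0}"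

text \<open>The empty list contributes the empty sum \<open>0\<close>.\<close>

definition generated_monoid :: "int set \<Rightarrow> int set" where
  "generated_monoid X = {sum_list xs | xs. set xs \<subseteq> X}"

definition orbit_monoid :: "int \<Rightarrow> int \<Rightarrow> int \<Rightarrow> int set" where
  "orbit_monoid a b m = generated_monoid (range (\<lambda>i. (affine_map a b ^^ i) m))"

end

theory Submission
  imports Defs
begin

text \<open>
  The orbit of \<open>m\<close> stays above \<open>m\<close>, because \<open>b \<ge> - (a - 1) * m\<close> means \<open>T m \<ge> m\<close>. It contains the
  coprime numbers \<open>m\<close> and \<open>T m = a * m + b\<close>, so the monoid it generates is cofinite. Closure under
  \<open>T\<close> follows from \<open>T (g + y) = T g + a * y\<close>, where a nonzero element has been written as an orbit
  element \<open>g\<close> plus a further element \<open>y\<close> of the monoid.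
\<close>

lemma generated_monoid_zero: "0 \<in> generated_monoid X"
  unfolding generated_monoid_def by (auto intro!: exI[of _ "[]"])

lemma generated_monoid_base: "x \<in> X \<Longrightarrow> x \<in> generated_monoid X"
  unfolding generated_monoid_def by (auto intro!: exI[of _ "[x]"])

lemma generated_monoid_add:
  assumes "x \<in> generated_monoid X" "y \<in> generated_monoid X"
  shows "x + y \<in> generated_monoid X"
proof -
  obtain xs ys where "x = sum_list xs" "y = sum_list ys" "set xs \<subseteq> X" "set ys \<subseteq> X"
    using assms unfolding generated_monoid_def by blast
  then show ?thesis
    unfolding generated_monoid_def by (auto intro!: exI[of _ "xs @ ys"])
qed

lemma generated_monoid_mult:
  assumes "x \<in> generated_monoid X" "0 \<le> k"
  shows "k * x \<in> generated_monoid X"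
proof -
  have "int n * x \<in> generated_monoid X" for n
    by (induction n)
      (auto simp: algebra_simps intro: generated_monoid_zero generated_monoid_add assms(1))
  from this[of "nat k"] show ?thesis using assms(2) by simp
qed

text \<open>Splits off the head of a list of generators. This isolates a single orbit element, on
  which the lower bound and closure arguments for \<open>M\<close> rest.\<close>

lemma generated_monoid_cases:
  assumes "x \<in> generated_monoid X"
  obtains "x = 0" | g y where "x = g + y" "g \<in> X" "y \<in> generated_monoid X"
proof -
  obtain xs where xs: "x = sum_list xs" "set xs \<subseteq> X"
    using assms unfolding generated_monoid_def by blast
  show thesis
  proof (cases xs)
    case Nil
    then show thesis using xs that(1) by simp
  next
    case (Cons g ys)
    then have "sum_list ys \<in> generated_monoid X"
      using xs unfolding generated_monoid_def by auto
    then show thesis using Cons xs that(2) by simp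
  qed
qed

lemma generated_monoid_least:
  assumes "X \<subseteq> S" "0 \<in> S" "\<And>x y. x \<in> S \<Longrightarrow> y \<in> S \<Longrightarrow> x + y \<in> S"
  shows "generated_monoid X \<subseteq> S"
proof -
  have "sum_list xs \<in> S" if "set xs \<subseteq> X" for xs
    using that by (induction xs) (use assms in auto)
  then show ?thesis unfolding generated_monoid_def by blast
qed

text \<open>Reducing the Bezout coefficient of \<open>n\<close> modulo \<open>m\<close> makes
  \<open>c\<close> nonnegative and less than \<open>m\<close>. Then \<open>c * n\<close> is at most
  \<open>m * n\<close>, hence at most \<open>z\<close>, so the other coefficient cannot be
  negative.\<close>

lemma coprime_nonneg_combination:
  fixes m n z :: int
  assumes "0 < m" "0 < n" "coprime m n" "m * n \<le> z"
  obtains c d where "0 \<le> c" "0 \<le> d" "z = c * n + d * m"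
proof -
  obtain u v where uv: "u * n + v * m = 1"
    using bezout_int[of n m] assms(3) by (auto simp: coprime_iff_gcd_eq_1 gcd.commute)
  define c where "c = (z * u) mod m"
  have c: "0 \<le> c" "c < m" using assms(1) by (auto simp: c_def)
  have "z - c * n = z * (u * n + v * m) - c * n" by (simp add: uv)
  also have "\<dots> = (z * u - c) * n + z * v * m" by (simp add: algebra_simps)
  \<comment> \<open>Both summands are multiples of \<open>m\<close>, the first because
    \<open>c\<close> is the residue of \<open>z * u\<close>.\<close>
  finally have "m dvd z - c * n" by (simp add: c_def mod_eq_dvd_iff dvd_minus_mod)
  then obtain d where d: "z - c * n = d * m" by (metis dvdE mult.commute)
  have "c * n \<le> m * n" using c assms(2) by simp
  then have "0 \<le> d * m" using d assms(4) by linarith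
  then have "0 \<le> d" using assms(1) by (simp add: zero_le_mult_iff)
  with c d that show thesis by (auto simp: algebra_simps)
qed

lemma Nats_eq: "(\<nat> :: int set) = {0..}"
  by (auto simp: Nats_altdef2 Ints_def)

text \<open>The integers are not well-ordered, so \<open>LEAST\<close> need not be attained.
  Cofiniteness supplies a positive element; the least one is found among the naturals and
  transferred.\<close>

lemma ns_multiplicity_mem:
  assumes "numerical_semigroup S"
  shows "ns_multiplicity S \<in> S \<and> 0 < ns_multiplicity S"
proof -
  have S: "finite (\<nat> - S)"
    using assms unfolding numerical_semigroup_def by blast
  have "infinite (int ` {0<..})"
    by (simp add: finite_image_iff infinite_Ioi)
  then have "\<not> int ` {0<..} \<subseteq> \<nat> - S" using S finite_subset by blast
  then obtain n where n: "int n \<in> S \<and> 0 < int n" by auto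
  define k where "k = (LEAST n. int n \<in> S \<and> 0 < int n)"
  have k: "int k \<in> S \<and> 0 < int k"
    unfolding k_def using n by (rule LeastI)
  have "ns_multiplicity S = int k"
    unfolding ns_multiplicity_def
  proof (rule Least_equality)
    show "int k \<in> S \<and> 0 < int k" by (fact k)
  next
    fix y assume y: "y \<in> S \<and> 0 < y"
    then have "k \<le> nat y" unfolding k_def by (intro Least_le) simp
    then show "int k \<le> y" using y by linarith
  qed
  with k show ?thesis by simp
qed

theorem theorem2p4:
  fixes a b m :: int
  assumes "m > 1"
    and "a \<ge> 2"
    and "b \<ge> - (a - 1) * m"
    and "gcd b m = 1"
  shows "numerical_semigroup (orbit_monoid a b m) \<and>
         ns_multiplicity (orbit_monoid a b m) = m \<and>
         closed_under_affine a b (orbit_monoid a b m) \<and>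
         (\<forall>S. numerical_semigroup S \<and> ns_multiplicity S = m \<and> closed_under_affine a b S
              \<longrightarrow> orbit_monoid a b m \<subseteq> S)"
proof -
  define X where "X = range (\<lambda>i. (affine_map a b ^^ i) m)"
  define M where "M = generated_monoid X"
  have M_orbit: "orbit_monoid a b m = M" by (simp add: orbit_monoid_def M_def X_def)
  have step: "m \<le> affine_map a b x" if "m \<le> x" for x
  proof -
    have "a * m \<le> a * x" using that assms(2) by simp
    then show ?thesis using assms(3) by (simp add: affine_map_def algebra_simps)
  qed
  have "m \<le> (affine_map a b ^^ i) m" for i
    by (induction i) (auto intro: step)
  then have X_ge: "m \<le> x" if "x \<in> X" for x using that by (auto simp: X_def)
  have X_m: "m \<in> X" unfolding X_def by (rule range_eqI[of _ _ 0]) simp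
  have X_step: "affine_map a b x \<in> X" if x: "x \<in> X" for x
  proof -
    obtain i where "x = (affine_map a b ^^ i) m" using x unfolding X_def by blast
    then have "affine_map a b x = (affine_map a b ^^ Suc i) m" by simp
    then show ?thesis unfolding X_def by blast
  qed
  \<comment> \<open>The nonnegative integers form a monoid containing the orbit, hence contain all
    of \<open>M\<close>.\<close>
  have M_nonneg: "0 \<le> x" if "x \<in> M" for x
    using generated_monoid_least[of X "{0..}"] X_ge assms(1) that
    unfolding M_def by fastforce
  have M_ge: "m \<le> x" if "x \<in> M" "x \<noteq> 0" for x
    using that(1) unfolding M_def
  proof (cases rule: generated_monoid_cases)
    case 1
    with that(2) show ?thesis by simp
  next
    case (2 g y)
    then show ?thesis using X_ge[of g] M_nonneg[of y] unfolding M_def by simp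
  qed
  have ns: "numerical_semigroup M"
    unfolding numerical_semigroup_def
  proof (intro conjI ballI)
    show "M \<subseteq> \<nat>" using M_nonneg by (auto simp: Nats_eq)
    show "0 \<in> M" unfolding M_def by (rule generated_monoid_zero)
    show "x + y \<in> M" if "x \<in> M" "y \<in> M" for x y
      using that unfolding M_def by (rule generated_monoid_add)
    define n where "n = affine_map a b m"
    have n: "n \<in> X" using X_step[OF X_m] by (simp add: n_def)
    \<comment> \<open>Since \<open>n = a * m + b\<close>, the gcd of \<open>m\<close> and
      \<open>n\<close> equals that of \<open>m\<close> and \<open>b\<close>.\<close>
    have "coprime m n"
      using assms(4)
      by (simp add: n_def affine_map_def coprime_iff_gcd_eq_1 gcd.commute gcd_add_mult)
    \<comment> \<open>The generators \<open>m\<close> and \<open>n\<close> alone reach every integer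
      from \<open>m * n\<close> on, a crude bound that suffices for finiteness.\<close>
    have "z \<in> M" if z: "m * n \<le> z" for z
    proof -
      obtain c d where "0 \<le> c" "0 \<le> d" "z = c * n + d * m"
        using coprime_nonneg_combination[of m n z] \<open>coprime m n\<close> X_ge[OF n] assms(1) z
        by auto
      then show ?thesis
        unfolding M_def
        by (simp add: generated_monoid_add generated_monoid_mult generated_monoid_base n X_m)
    qed
    then have "\<nat> - M \<subseteq> {0..<m * n}" by (auto simp: Nats_eq not_le[symmetric])
    then show "finite (\<nat> - M)" by (rule finite_subset) simp
  qed
  have mult: "ns_multiplicity M = m"
    unfolding ns_multiplicity_def
    using generated_monoid_base[OF X_m] assms(1) M_ge
    by (intro Least_equality) (auto simp: M_def)
  have closed: "closed_under_affine a b M"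
    unfolding closed_under_affine_def
  proof (intro image_subsetI)
    fix x assume x: "x \<in> M - {0}"
    then have "x \<in> generated_monoid X" by (simp add: M_def)
    then show "affine_map a b x \<in> M - {0}"
    proof (cases rule: generated_monoid_cases)
      case 1
      with x show ?thesis by simp
    next
      case (2 g y)
      \<comment> \<open>The shift \<open>b\<close>, possibly negative, is absorbed by the one orbit
        element \<open>g\<close>; the remainder is only scaled by the positive \<open>a\<close>, so
        both summands stay in \<open>M\<close>.\<close>
      have eq: "affine_map a b x = affine_map a b g + a * y"
        by (simp add: 2 affine_map_def algebra_simps)
      have "affine_map a b x \<in> M"
        unfolding eq M_def using 2 X_step assms(2)
        by (simp add: generated_monoid_add generated_monoid_mult generated_monoid_base)
      moreover have "0 < affine_map a b x"
        using step[of x] M_ge[of x] x assms(1) by auto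
      ultimately show ?thesis by simp
    qed
  qed
  have least: "M \<subseteq> S"
    if S: "numerical_semigroup S" "ns_multiplicity S = m" "closed_under_affine a b S" for S
  proof -
    \<comment> \<open>The induction must carry nonzeroness along, because closure of
      \<open>S\<close> speaks only of nonzero elements.\<close>
    have "(affine_map a b ^^ i) m \<in> S - {0}" for i
    proof (induction i)
      case 0
      then show ?case using ns_multiplicity_mem[OF S(1)] S(2) by auto
    next
      case (Suc i)
      then show ?case using S(3) unfolding closed_under_affine_def by auto
    qed
    then have "X \<subseteq> S" by (auto simp: X_def)
    then show ?thesis
      using S(1) unfolding M_def numerical_semigroup_def
      by (intro generated_monoid_least) auto
  qed
  show ?thesis unfolding M_orbit using ns mult closed least by blast
qed

end
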